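(* Let $(V,H,L)$ be a holonomic space. Then $H=\{\mathrm{id}_V\}$ if and only if there exists $u\in V$ for which the holonomy radius $\mathrm{HolRad}(u)$ is not finite.
   Context: A group-norm on a group $G$ is a function $N:G\to\mathbb{R}$ such that $N(A)\ge 0$; $N(A)=0$ if and only if $A$ is the identity; $N(A^{-1})=N(A)$; and $N(AB)\le N(A)+N(B)$, for all $A,B\in G$. A triplet $(V,H,L)$, with $V$ a normed vector space, $H$ a subgroup of the group of norm-preserving linear automorphisms of $V$, and $L:H\to\mathbb{R}$ a group-norm on $H$, is a holonomic space if: (P) for all $u\in V$ there exists $r>0$ such that for all $v,w\in V$ with $\|v-u\|<r$, $\|w-u\|<r$, and all $A\in H$, $$\|v-w\|^2-\|v-Aw\|^2\le L^2(A).$$ The holonomy radius $\mathrm{HolRad}(u)\in(0,\infty]$ of $u\in V$ is the supremum of the radii $r>0$ for which the condition in (P) holds at $u$. *)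

theory Defs
  imports Complex_Main "HOL-Library.Extended_Real" "HOL-Algebra.Group"
begin

definition group_norm :: "('g, 'm) monoid_scheme \<Rightarrow> ('g \<Rightarrow> real) \<Rightarrow> bool" where
  "group_norm G N \<longleftrightarrow>
     group G \<and>
     (\<forall>A\<in>carrier G. 0 \<le> N A) \<and>
     (\<forall>A\<in>carrier G. N A = 0 \<longleftrightarrow> A = \<one>\<^bsub>G\<^esub>) \<and>
     (\<forall>A\<in>carrier G. N (inv\<^bsub>G\<^esub> A) = N A) \<and>
     (\<forall>A\<in>carrier G. \<forall>B\<in>carrier G. N (A \<otimes>\<^bsub>G\<^esub> B) \<le> N A + N B)"

text \<open>Norm preservation does not imply surjectivity in infinite dimensions, so bijectivity is
  required separately.\<close>

definition isometry_group :: "('v::real_normed_vector \<Rightarrow> 'v) monoid" where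
  "isometry_group =
     \<lparr>carrier = {A. linear A \<and> bij A \<and> (\<forall>v. norm (A v) = norm v)},
      mult = (\<circ>),
      one = id\<rparr>"

lemma group_isometry_group: "group (isometry_group :: ('v::real_normed_vector \<Rightarrow> 'v) monoid)"
proof (rule groupI)
  fix A :: "'v \<Rightarrow> 'v"
  assume "A \<in> carrier isometry_group"
  then have A: "linear A" "bij A" "\<And>v. norm (A v) = norm v"
    by (auto simp: isometry_group_def)
  let ?B = "inv_into UNIV A"
  have AB: "A (?B v) = v" for v
    using A(2) by (simp add: bij_is_surj surj_f_inv_f)
  have BA: "?B (A v) = v" for v
    using A(2) by (simp add: bij_is_inj inv_f_f)
  have "linear ?B"
  proof (rule linearI)
    show "?B (v + w) = ?B v + ?B w" for v w
      using BA[of "?B v + ?B w"] by (simp add: linear_add[OF A(1)] AB)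
    show "?B (c *\<^sub>R v) = c *\<^sub>R ?B v" for c v
      using BA[of "c *\<^sub>R ?B v"] by (simp add: linear_scale[OF A(1)] AB)
  qed
  moreover have "bij ?B"
    using A(2) by (rule bij_imp_bij_inv)
  moreover have "norm (?B v) = norm v" for v
    using A(3)[of "?B v"] by (simp add: AB)
  ultimately have "?B \<in> carrier isometry_group"
    by (simp add: isometry_group_def)
  moreover have "?B \<otimes>\<^bsub>isometry_group\<^esub> A = \<one>\<^bsub>isometry_group\<^esub>"
    by (simp add: isometry_group_def fun_eq_iff BA)
  ultimately show "\<exists>B\<in>carrier isometry_group. B \<otimes>\<^bsub>isometry_group\<^esub> A = \<one>\<^bsub>isometry_group\<^esub>"
    by blast
qed (auto simp: isometry_group_def linear_compose bij_comp module_hom_id comp_assoc)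

definition holonomic_at ::
    "('v::real_normed_vector \<Rightarrow> 'v) set \<Rightarrow> (('v \<Rightarrow> 'v) \<Rightarrow> real) \<Rightarrow> 'v \<Rightarrow> real \<Rightarrow> bool" where
  "holonomic_at H L u r \<longleftrightarrow>
     (\<forall>v w. norm (v - u) < r \<longrightarrow> norm (w - u) < r \<longrightarrow>
        (\<forall>A\<in>H. (norm (v - w))\<^sup>2 - (norm (v - A w))\<^sup>2 \<le> (L A)\<^sup>2))"

text \<open>The space \<open>V\<close> is the whole type \<open>'v\<close>; only the values of \<open>L\<close> on \<open>H\<close> matter.\<close>

definition holonomic_space ::
    "('v::real_normed_vector \<Rightarrow> 'v) set \<Rightarrow> (('v \<Rightarrow> 'v) \<Rightarrow> real) \<Rightarrow> bool" where
  "holonomic_space H L \<longleftrightarrow>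
     subgroup H isometry_group \<and>
     group_norm (isometry_group\<lparr>carrier := H\<rparr>) L \<and>
     (\<forall>u. \<exists>r>0. holonomic_at H L u r)"

definition HolRad ::
    "('v::real_normed_vector \<Rightarrow> 'v) set \<Rightarrow> (('v \<Rightarrow> 'v) \<Rightarrow> real) \<Rightarrow> 'v \<Rightarrow> ereal" where
  "HolRad H L u = (SUP r\<in>{r. 0 < r \<and> holonomic_at H L u r}. ereal r)"

end

theory Submission
  imports Defs
begin

text \<open>If the holonomy radius at some point is infinite, the inequality in (P) holds for all
  \<open>v\<close>, \<open>w\<close>. With \<open>v = A w\<close> it bounds \<open>norm (A w - w)\<close> by \<open>\<bar>L A\<bar>\<close> uniformly in \<open>w\<close>, and a
  bounded linear-homogeneous quantity vanishes. Conversely, for \<open>A = id\<close> the left-hand side of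
  the inequality is zero.\<close>

text \<open>The condition passes to smaller radii, so \<open>r\<close> inherits it from an
  admissible radius above \<open>r\<close>, even if the supremum is not attained.\<close>

lemma holonomic_at_if_less_HolRad:
  assumes "ereal r < HolRad H L u"
  shows "holonomic_at H L u r"
proof -
  obtain s where "holonomic_at H L u s" "r < s"
    using assms by (auto simp: HolRad_def less_SUP_iff)
  then show ?thesis
    unfolding holonomic_at_def by (meson order.strict_trans)
qed

lemma HolRad_eq_infinityI:
  assumes "\<And>r. 0 < r \<Longrightarrow> holonomic_at H L u r"
  shows "HolRad H L u = \<infinity>"
  unfolding HolRad_def
proof (rule SUP_PInfty)
  fix n :: nat
  show "\<exists>r\<in>{r. 0 < r \<and> holonomic_at H L u r}. ereal (real n) \<le> ereal r"
    \<comment> \<open>The summand 1 keeps the radius positive when \<open>n\<close> is 0.\<close>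
    using assms by (intro bexI[of _ "real n + 1"]) auto
qed

lemma infinite_HolRad_imp_holonomic_ineq:
  assumes "HolRad H L u = \<infinity>" "A \<in> H"
  shows "(norm (v - w))\<^sup>2 - (norm (v - A w))\<^sup>2 \<le> (L A)\<^sup>2"
proof -
  \<comment> \<open>The radius is large enough for the open ball around \<open>u\<close> to contain
    both \<open>v\<close> and \<open>w\<close>.\<close>
  have "holonomic_at H L u (max (norm (v - u)) (norm (w - u)) + 1)"
    using assms by (intro holonomic_at_if_less_HolRad) simp
  then show ?thesis
    using assms(2) unfolding holonomic_at_def by fastforce
qed

text \<open>Replacing \<open>w\<close> by its multiple by \<open>n\<close> scales the displacement
  by \<open>n\<close> while \<open>C\<close> stays fixed, so the Archimedean property excludes a
  positive displacement.\<close>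

lemma linear_eq_id_if_bounded_displacement:
  fixes A :: "'v::real_normed_vector \<Rightarrow> 'v"
  assumes "linear A" and bound: "\<And>w. norm (A w - w) \<le> C"
  shows "A = id"
proof
  fix w
  have "real n * norm (A w - w) \<le> C" for n
    using bound[of "real n *\<^sub>R w"]
    by (simp add: linear_scale[OF assms(1)] flip: scaleR_diff_right)
  then have "\<not> 0 < norm (A w - w)"
    using reals_Archimedean3 by (meson not_less)
  then show "A w = id w" by simp
qed

theorem proposition2p13:
  fixes H :: "('v::real_normed_vector \<Rightarrow> 'v) set"
    and L :: "('v \<Rightarrow> 'v) \<Rightarrow> real"
  assumes "holonomic_space H L"
  shows "H = {id} \<longleftrightarrow> (\<exists>u. HolRad H L u = \<infinity>)"
proof
  assume "H = {id}"
  \<comment> \<open>The point 0 is an arbitrary choice: every radius works at every point.\<close>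
  then have "HolRad H L 0 = \<infinity>"
    by (intro HolRad_eq_infinityI) (simp add: holonomic_at_def)
  then show "\<exists>u. HolRad H L u = \<infinity>" ..
next
  assume "\<exists>u. HolRad H L u = \<infinity>"
  then obtain u where u: "HolRad H L u = \<infinity>" ..
  have sub: "subgroup H isometry_group"
    using assms by (simp add: holonomic_space_def)
  have "A = id" if "A \<in> H" for A
  proof (rule linear_eq_id_if_bounded_displacement)
    show "linear A"
      using subgroup.mem_carrier[OF sub that] by (simp add: isometry_group_def)
    show "norm (A w - w) \<le> \<bar>L A\<bar>" for w
      using infinite_HolRad_imp_holonomic_ineq[OF u that, of "A w" w]
      by (simp add: abs_le_square_iff[symmetric])
  qed
  moreover have "id \<in> H"
    using subgroup.one_closed[OF sub] by (simp add: isometry_group_def)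
  ultimately show "H = {id}" by blast
qed

end
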